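(* For all integers $m$ and $n$ such that $4\le m\le n$ and $(m,n)\notin\{(4,4),(4,5),(6,8)\}$, there exists a Toeplitz matrix of order $n$ in $\mathcal{T}_{\le 2}$ whose row graph contains a cycle component of length $m$ (that is, a connected component which is a cycle of length $m$).
   Context: Write $[m]=\{1,\dots,m\}$. For disjoint subsets $\alpha,\beta\subseteq[n-1]$, not both empty, $T_n\langle\alpha;\beta\rangle$ denotes the $n\times n$ $(0,1)$-matrix $(t_{u,v})$ with $t_{u,v}=1$ if and only if $u-v\in\alpha$ or $v-u\in\beta$; "Toeplitz matrix of order $n$" here means a matrix of this form. $\mathcal{T}_{\le 2}$ is the set of such matrices with maximum row sum (computed in the integers) at most $2$. The row graph $\mathrm{RG}(T)$ of an $n\times n$ $(0,1)$-matrix $T=(t_{u,v})$ is the simple graph with vertex set $[n]$ in which two distinct vertices $u,v$ are adjacent if and only if $t_{u,k}=t_{v,k}=1$ for some $k\in[n]$. *)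

theory Defs
  imports "Jordan_Normal_Form.Matrix" "Graph_Theory.Graph_Theory"
begin

text \<open>
  Rows and columns are numbered from 0, as usual for \<^typ>\<open>int mat\<close>: the index \<open>u\<close> stands for
  the row or column \<open>u + 1\<close> in the numbering by \<open>{1..n}\<close>.  Toeplitz entries depend only on the
  difference of the two indices, so their definition is unaffected by this shift.  The guards
  \<open>v < u\<close> and \<open>u < v\<close> make the truncated subtraction on \<^typ>\<open>nat\<close> the true difference.
\<close>

definition toeplitz :: "nat \<Rightarrow> nat set \<Rightarrow> nat set \<Rightarrow> int mat" where
  "toeplitz n \<alpha> \<beta> = mat n n (\<lambda>(u, v).
     if (v < u \<and> u - v \<in> \<alpha>) \<or> (u < v \<and> v - u \<in> \<beta>) then 1 else 0)"

definition toeplitz_mats :: "nat \<Rightarrow> int mat set" where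
  "toeplitz_mats n = {toeplitz n \<alpha> \<beta> | \<alpha> \<beta>.
     \<alpha> \<subseteq> {1..<n} \<and> \<beta> \<subseteq> {1..<n} \<and> \<alpha> \<inter> \<beta> = {} \<and> \<not> (\<alpha> = {} \<and> \<beta> = {})}"

definition row_sum :: "int mat \<Rightarrow> nat \<Rightarrow> int" where
  "row_sum T u = (\<Sum>v\<in>{0..<dim_col T}. T $$ (u, v))"

definition max_row_sum :: "int mat \<Rightarrow> int" where
  "max_row_sum T = Max (row_sum T ` {0..<dim_row T})"

text \<open>The maximum is over a nonempty set here: \<open>toeplitz_mats n\<close> is empty unless \<open>n \<ge> 2\<close>.\<close>

definition toeplitz_le2 :: "int mat set" where
  "toeplitz_le2 = {T. (\<exists>n. T \<in> toeplitz_mats n) \<and> max_row_sum T \<le> 2}"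

text \<open>Simple graphs are loop-free symmetric digraphs, each edge giving two opposite arcs.\<close>

definition row_graph :: "int mat \<Rightarrow> nat pair_pre_digraph" where
  "row_graph T = \<lparr> pverts = {0..<dim_row T},
     parcs = {(u, v). u < dim_row T \<and> v < dim_row T \<and> u \<noteq> v \<and>
                      (\<exists>k<dim_col T. T $$ (u, k) = 1 \<and> T $$ (v, k) = 1)} \<rparr>"

text \<open>The cycle of length \<open>m\<close>; to be used for \<open>m \<ge> 3\<close> only.\<close>

definition cycle_graph :: "nat \<Rightarrow> nat pair_pre_digraph" where
  "cycle_graph m = \<lparr> pverts = {0..<m},
     parcs = {(i, j). i < m \<and> j < m \<and> (j = Suc i mod m \<or> i = Suc j mod m)} \<rparr>"

text \<open>In a symmetric digraph the strongly connected components are the connected components of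
  the underlying simple graph.\<close>

definition has_cycle_component :: "nat pair_pre_digraph \<Rightarrow> nat \<Rightarrow> bool" where
  "has_cycle_component G m \<longleftrightarrow>
     (\<exists>C \<in> pre_digraph.sccs (with_proj G). digraph_iso C (with_proj (cycle_graph m)))"

end

theory Submission
  imports Defs
begin

text \<open>
  Take \<open>\<alpha> = {a, a'}\<close> and \<open>\<beta> = {b, b'}\<close> with \<open>a < a'\<close>, \<open>b < b'\<close>, \<open>a' + b \<ge> n\<close> and
  \<open>a + b' \<ge> n\<close>.  These inequalities keep every row sum at most 2, and they also leave only three
  ways for two rows \<open>u < v\<close> to share a column: at distance \<open>a' - a\<close> with both rows in \<open>[a, n)\<close>,
  at distance \<open>b' - b\<close> with both rows in \<open>[0, n - b)\<close>, or at distance \<open>a + b\<close>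
  (\<open>row_graph_arc_iff\<close>).

  Choose now \<open>a = p\<close> and \<open>b = n - 1 - p\<close>.  The two intervals become \<open>[p, n - 1]\<close> and \<open>[0, p]\<close>,
  which meet only in \<open>p\<close>, and the distance \<open>a + b\<close> is attained by the pair \<open>0\<close>, \<open>n - 1\<close> alone.
  If \<open>b' - b = e\<close> divides \<open>p\<close> and \<open>a' - a = d\<close> divides \<open>n - 1 - p\<close>, then walking from \<open>0\<close> to
  \<open>p\<close> in steps of \<open>e\<close>, on to \<open>n - 1\<close> in steps of \<open>d\<close>, and back to \<open>0\<close> by the long edge
  is a cycle component of length \<open>p / e + (n - 1 - p) / d + 1\<close> (\<open>two_step_cycle\<close>).

  With a single step of length \<open>p = n - m + 1\<close> followed by unit steps this length is \<open>m\<close>, and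
  \<open>\<alpha>\<close> and \<open>\<beta>\<close> are disjoint unless \<open>n\<close> is \<open>2m - 3\<close> or \<open>2m - 4\<close>.  In these two cases a walk that
  takes unit steps up to \<open>p = 2\<close> or \<open>p = 3\<close>, and then steps of length 2, has length \<open>m\<close>; its two
  sets are disjoint as soon as \<open>m \<ge> 6\<close> or \<open>m \<ge> 7\<close>, respectively.  For \<open>m = 5\<close> a different choice
  of the four numbers gives a 5-cycle for all \<open>n \<ge> 5\<close> (\<open>five_cycle\<close>).  What is left is exactly
  the list of excluded pairs.
\<close>

section \<open>Recognising a cycle component\<close>

text \<open>
  If the arcs leaving each \<open>c i\<close> are exactly those to its two cyclic neighbours, then the vertices
  \<open>c i\<close> are reachable from one another and from nowhere else, so they span a component.
\<close>

lemma has_cycle_componentI: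
  assumes sym: "pair_sym_digraph G" and m: "0 < m"
    and inj: "inj_on c {0..<m}" and cV: "\<And>i. i < m \<Longrightarrow> c i \<in> pverts G"
    and arcs: "\<And>i w. i < m \<Longrightarrow> (c i, w) \<in> parcs G \<longleftrightarrow>
      (\<exists>j<m. w = c j \<and> (j = Suc i mod m \<or> i = Suc j mod m))"
  shows "has_cycle_component G m"
proof -
  interpret pair_sym_digraph G by (rule sym)
  have fwd: "i < m \<Longrightarrow> c 0 \<rightarrow>\<^sup>*\<^bsub>with_proj G\<^esub> c i" for i
  proof (induction i)
    case 0
    then show ?case using cV by auto
  next
    case (Suc i)
    then have "(c i, c (Suc i)) \<in> parcs G"
      by (subst arcs) auto
    then show ?case
      using Suc reachable_adj_trans by fastforce
  qed
  have closed: "c 0 \<rightarrow>\<^sup>*\<^bsub>with_proj G\<^esub> v \<Longrightarrow> v \<in> c ` {0..<m}" for v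
  proof (induction v rule: reachable_induct)
    case base
    then show ?case using m by auto
  next
    case (step x y)
    then show ?case using arcs by auto
  qed
  have reach: "{v. c 0 \<rightarrow>\<^sup>*\<^bsub>with_proj G\<^esub> v} = c ` {0..<m}"
    using fwd closed by auto
  let ?C = "with_proj G \<restriction> c ` {0..<m}"
  have scc: "?C \<in> pre_digraph.sccs (with_proj G)"
    using induce_reachable_is_in_sccs[of "c 0"] cV m unfolding reach by simp
  define g where "g = the_inv_into {0..<m} c"
  have g: "g (c i) = i" if "i < m" for i
    unfolding g_def using that by (intro the_inv_into_f_f[OF inj]) auto
  have CV: "verts ?C = c ` {0..<m}"
    and CA: "arcs ?C = {e \<in> parcs G. fst e \<in> c ` {0..<m} \<and> snd e \<in> c ` {0..<m}}"
    and CT: "tail ?C = fst" and CH: "head ?C = snd"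
    by (simp_all add: induce_subgraph_def)
  define f where "f = \<lparr>iso_verts = g, iso_arcs = map_prod g g, iso_head = snd, iso_tail = fst\<rparr>"
  have inv: "c (g x) = x" if "x \<in> c ` {0..<m}" for x
    using that g by auto
  have "wf_digraph ?C"
    by (rule wf_digraph.intro) (auto simp: CV CA CT CH)
  moreover have "inj_on g (verts ?C)"
    unfolding CV by (rule inj_on_inverseI[where g = c]) (rule inv)
  moreover have "inj_on (map_prod g g) (arcs ?C)"
    by (rule inj_on_inverseI[where g = "map_prod c c"]) (auto simp: CA g)
  ultimately have iso: "pre_digraph.digraph_isomorphism ?C f"
    unfolding pre_digraph.digraph_isomorphism_def f_def by (auto simp: CT CH)
  have "map_prod g g ` arcs ?C = parcs (cycle_graph m)" (is "?L = ?R")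
  proof
    show "?L \<subseteq> ?R"
    proof
      fix x assume "x \<in> ?L"
      then obtain i j where ij: "i < m" "j < m" "(c i, c j) \<in> parcs G" and x: "x = (i, j)"
        using g by (auto simp: CA)
      from ij(3) arcs[OF ij(1)] obtain k where
        k: "k < m" "c j = c k" "k = Suc i mod m \<or> i = Suc k mod m" by auto
      with ij(2) have "k = j" using inj by (auto simp: inj_on_def)
      with k ij x show "x \<in> ?R" by (auto simp: cycle_graph_def)
    qed
    show "?R \<subseteq> ?L"
    proof
      fix x assume "x \<in> ?R"
      then obtain i j where x: "x = (i, j)" and ij: "i < m" "j < m"
        "j = Suc i mod m \<or> i = Suc j mod m" by (auto simp: cycle_graph_def)
      then have "(c i, c j) \<in> arcs ?C" using arcs[OF ij(1)] by (auto simp: CA)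
      moreover have "x = map_prod g g (c i, c j)" using x ij g by simp
      ultimately show "x \<in> ?L" by blast
    qed
  qed
  moreover have "g ` verts ?C = pverts (cycle_graph m)"
    unfolding CV by (force simp: cycle_graph_def g image_image)
  ultimately have "with_proj (cycle_graph m) = app_iso f ?C"
    by (simp add: app_iso_def f_def with_proj_def)
  with iso have "digraph_iso ?C (with_proj (cycle_graph m))"
    unfolding digraph_iso_def by blast
  with scc show ?thesis unfolding has_cycle_component_def by blast
qed

section \<open>Toeplitz matrices with two subdiagonals and two superdiagonals\<close>

lemma row_graph_pair_sym_digraph: "pair_sym_digraph (row_graph T)"
  by unfold_locales (auto simp: row_graph_def symmetric_def sym_def)

locale four_diagonals =
  fixes n a a' b b' :: nat
  assumes pos: "0 < a" "0 < b" and less: "a < a'" "b < b'" and bound: "a' < n" "b' < n"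
    and disj: "{a, a'} \<inter> {b, b'} = {}"
    and far: "n \<le> a' + b" "n \<le> a + b'"
begin

abbreviation T :: "int mat" where "T \<equiv> toeplitz n {a, a'} {b, b'}"

lemma dims: "dim_row T = n" "dim_col T = n"
  by (simp_all add: toeplitz_def)

lemma entry_iff:
  assumes "u < n" "k < n"
  shows "T $$ (u, k) = 1 \<longleftrightarrow> u = k + a \<or> u = k + a' \<or> k = u + b \<or> k = u + b'"
  using assms pos less by (auto simp: toeplitz_def)

lemma entry_01:
  assumes "u < n" "k < n"
  shows "T $$ (u, k) = (if T $$ (u, k) = 1 then 1 else 0)"
  using assms by (auto simp: toeplitz_def)

lemma in_toeplitz_mats: "T \<in> toeplitz_mats n"
proof -
  have "{a, a'} \<subseteq> {1..<n}" "{b, b'} \<subseteq> {1..<n}"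
    using pos less bound by auto
  then show ?thesis
    unfolding toeplitz_mats_def using disj by blast
qed

text \<open>
  Row \<open>u\<close> contains an entry of the diagonal \<open>x \<in> \<alpha>\<close> iff \<open>x \<le> u\<close>, and one of \<open>y \<in> \<beta>\<close> iff
  \<open>u + y < n\<close>.  By \<open>far\<close>, a row that meets both \<open>a\<close> and \<open>b\<close> meets neither \<open>a'\<close> nor \<open>b'\<close>.
\<close>

lemma row_sum_le2:
  assumes "u < n"
  shows "row_sum T u \<le> 2"
proof -
  have "row_sum T u = (\<Sum>v\<in>{0..<n}. if T $$ (u, v) = 1 then 1 else 0)"
    unfolding row_sum_def dims using entry_01[OF assms] by (intro sum.cong) auto
  also have "\<dots> = int (card {v \<in> {0..<n}. T $$ (u, v) = 1})"
    by (simp flip: sum.inter_filter)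
  finally have sum: "row_sum T u = int (card {v \<in> {0..<n}. T $$ (u, v) = 1})" .
  have "\<exists>x y. {v \<in> {0..<n}. T $$ (u, v) = 1} \<subseteq> {x, y}"
  proof -
    consider "u < a" | "n \<le> u + b" | "a \<le> u" "u + b < n" by linarith
    then show ?thesis
    proof cases
      case 1
      then have "{v \<in> {0..<n}. T $$ (u, v) = 1} \<subseteq> {u + b, u + b'}"
        using assms entry_iff less by auto
      then show ?thesis by blast
    next
      case 2
      then have "{v \<in> {0..<n}. T $$ (u, v) = 1} \<subseteq> {u - a, u - a'}"
        using assms entry_iff less by auto
      then show ?thesis by blast
    next
      case 3
      then have "{v \<in> {0..<n}. T $$ (u, v) = 1} \<subseteq> {u - a, u + b}"
        using assms entry_iff far by auto
      then show ?thesis by blast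
    qed
  qed
  then obtain x y where "{v \<in> {0..<n}. T $$ (u, v) = 1} \<subseteq> {x, y}" by blast
  then have "card {v \<in> {0..<n}. T $$ (u, v) = 1} \<le> card {x, y}"
    by (intro card_mono) auto
  also have "\<dots> \<le> 2" by (simp add: card_insert_if)
  finally have "card {v \<in> {0..<n}. T $$ (u, v) = 1} \<le> 2" .
  with sum show ?thesis by simp
qed

lemma in_toeplitz_le2: "T \<in> toeplitz_le2"
proof -
  have "max_row_sum T \<le> 2"
    unfolding max_row_sum_def dims using bound row_sum_le2 by (subst Max_le_iff) auto
  then show ?thesis
    unfolding toeplitz_le2_def using in_toeplitz_mats by auto
qed

text \<open>
  Two entries in a common column may both lie below the diagonal, both above it, or on either
  side.  In the mixed case \<open>far\<close> rules out every pair of diagonals except \<open>a\<close>, \<open>b\<close>, because no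
  two rows are \<open>n\<close> or more apart.
\<close>

lemma row_graph_arc_iff:
  assumes "u < v" "v < n"
  shows "(u, v) \<in> parcs (row_graph T) \<longleftrightarrow>
    a \<le> u \<and> v = u + (a' - a) \<or> v + b < n \<and> v = u + (b' - b) \<or> v = u + a + b" (is "?L \<longleftrightarrow> ?R")
proof -
  have eq: "?L \<longleftrightarrow> (\<exists>k<n. T $$ (u, k) = 1 \<and> T $$ (v, k) = 1)"
    using assms by (auto simp: row_graph_def dims)
  show ?thesis
  proof
    assume ?L
    then obtain k where k: "k < n" "T $$ (u, k) = 1" "T $$ (v, k) = 1"
      using eq by auto
    have "u < n" using assms by simp
    from k(2) have "u = k + a \<or> u = k + a' \<or> k = u + b \<or> k = u + b'"
      using entry_iff[OF \<open>u < n\<close> k(1)] by simp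
    moreover from k(3) have "v = k + a \<or> v = k + a' \<or> k = v + b \<or> k = v + b'"
      using entry_iff[OF assms(2) k(1)] by simp
    ultimately show ?R
      using assms k(1) less far by (elim disjE; linarith)
  next
    assume ?R
    then consider "a \<le> u" "v = u + (a' - a)" | "v + b < n" "v = u + (b' - b)" | "v = u + a + b"
      by blast
    then obtain k where k: "k < n" "u = k + a \<or> u = k + a' \<or> k = u + b \<or> k = u + b'"
      "v = k + a \<or> v = k + a' \<or> k = v + b \<or> k = v + b'"
    proof cases
      case 1
      show thesis by (rule that[of "u - a"]) (use 1 assms less in auto)
    next
      case 2
      show thesis by (rule that[of "v + b"]) (use 2 assms less in auto)
    next
      case 3
      show thesis by (rule that[of "u + b"]) (use 3 assms less in auto)
    qed
    have "u < n" using assms by simp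
    then have "T $$ (u, k) = 1" "T $$ (v, k) = 1"
      using k entry_iff assms(2) by simp_all
    then show ?L unfolding eq using k(1) by blast
  qed
qed

lemma row_graph_arc_sym: "(u, v) \<in> parcs (row_graph T) \<longleftrightarrow> (v, u) \<in> parcs (row_graph T)"
  by (auto simp: row_graph_def)

lemma row_graph_arcD: "(u, v) \<in> parcs (row_graph T) \<Longrightarrow> u < n \<and> v < n \<and> u \<noteq> v"
  by (auto simp: row_graph_def dims)

lemma row_graph_vertex: "u < n \<Longrightarrow> u \<in> pverts (row_graph T)"
  by (simp add: row_graph_def dims)

end

section \<open>The two constructions\<close>

text \<open>
  The cycle visits \<open>0, e, 2e, \<dots>, p = s e, p + d, \<dots>, p + t d = n - 1\<close>.  Steps of the two lengths
  do not mix: an edge of length \<open>e\<close> has to end at \<open>p\<close> or before, and one of length \<open>d\<close> cannot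
  start before \<open>p\<close>.  Since the walk is increasing, comparing vertices is comparing positions.
\<close>

lemma two_step_cycle:
  assumes n: "n = s * e + t * d + 1" and m: "m = s + t + 1"
    and pos: "0 < s" "0 < t" "0 < d" "0 < e"
    and disj: "{s * e, s * e + d} \<inter> {t * d, t * d + e} = {}"
  shows "\<exists>T \<in> toeplitz_le2. T \<in> toeplitz_mats n \<and> has_cycle_component (row_graph T) m"
proof -
  have le: "e \<le> s * e" "d \<le> t * d" using pos by auto
  interpret four_diagonals n "s * e" "s * e + d" "t * d" "t * d + e"
    by unfold_locales (use pos le disj n in \<open>auto simp: less_Suc_eq_le\<close>)
  let ?A = "parcs (row_graph T)"
  define c where "c i = (if i \<le> s then i * e else s * e + (i - s) * d)" for i
  have c_Suc: "c (Suc i) = c i + (if i < s then e else d)" for i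
  proof (cases "i < s")
    case False
    then obtain k where "i = s + k" using le_Suc_ex by fastforce
    then show ?thesis by (cases k) (auto simp: c_def algebra_simps)
  qed (simp add: c_def)
  have smono: "strict_mono c"
    using pos by (auto simp: strict_mono_Suc_iff c_Suc)
  note c_less = strict_mono_less[OF smono] and c_eq = strict_mono_eq[OF smono]
  note c_le = strict_mono_less_eq[OF smono]
  have c0: "c 0 = 0" and cs: "c s = s * e" and cm: "c (m - 1) = n - 1"
    using n m pos by (auto simp: c_def)
  have cn: "c i < n" if "i < m" for i
    using that c_le[of i "m - 1"] cm n by (simp add: less_Suc_eq_le)
  have up: "(c i, w) \<in> ?A \<longleftrightarrow> Suc i < m \<and> w = c (Suc i) \<or> i = 0 \<and> w = c (m - 1)"
    if i: "i < m" and w: "c i < w" "w < n" for i w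
  proof -
    have "(c i, w) \<in> ?A \<longleftrightarrow>
      c s \<le> c i \<and> w = c i + d \<or> w \<le> c s \<and> w = c i + e \<or> c i = 0 \<and> w = n - 1"
      unfolding row_graph_arc_iff[OF w] cs using w n by auto
    also have "c s \<le> c i \<and> w = c i + d \<longleftrightarrow> s \<le> i \<and> w = c (Suc i)"
      by (auto simp: c_le c_Suc)
    also have "w \<le> c s \<and> w = c i + e \<longleftrightarrow> i < s \<and> w = c (Suc i)"
    proof
      assume *: "w \<le> c s \<and> w = c i + e"
      then have "c i < c s" using w by simp
      then have "i < s" by (simp add: c_less)
      with * show "i < s \<and> w = c (Suc i)" by (simp add: c_Suc)
    next
      assume *: "i < s \<and> w = c (Suc i)"
      then have "w \<le> c s" using c_le[of "Suc i" s] by simp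
      with * show "w \<le> c s \<and> w = c i + e" by (simp add: c_Suc)
    qed
    also have "c i = 0 \<longleftrightarrow> i = 0" using c_eq[of i 0] c0 by simp
    also have "n - 1 = c (m - 1)" using cm by simp
    finally have "(c i, w) \<in> ?A \<longleftrightarrow> w = c (Suc i) \<or> i = 0 \<and> w = c (m - 1)" by auto
    moreover have "Suc i < m" if "w = c (Suc i)"
    proof -
      have "c (Suc i) \<le> c (m - 1)" using that w cm by simp
      then show ?thesis using m by (simp add: c_le)
    qed
    ultimately show ?thesis by auto
  qed
  have down: "(c i, w) \<in> ?A \<longleftrightarrow> (\<exists>j<m. w = c j \<and> (i = Suc j \<or> j = 0 \<and> i = m - 1))"
    if i: "i < m" and w: "w < c i" for i w
  proof
    assume L: "(c i, w) \<in> ?A"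
    have "w < n" using w cn[OF i] by simp
    have 1: "c s \<le> w \<and> c i = w + d \<or> c i \<le> c s \<and> c i = w + e \<or> w = 0 \<and> c i = n - 1"
      using L row_graph_arc_iff[OF w cn[OF i]] n cn[OF i] unfolding row_graph_arc_sym[of "c i"] cs
      by auto
    have "0 < i" using w c0 by (cases i) auto
    then obtain j where j: "i = Suc j" by (cases i) auto
    from 1 consider "c s \<le> w" "c i = w + d" | "c i \<le> c s" "c i = w + e" | "w = 0" "c i = n - 1"
      by blast
    then show "\<exists>j<m. w = c j \<and> (i = Suc j \<or> j = 0 \<and> i = m - 1)"
    proof cases
      case 1
      then have "c s < c i" using w by simp
      then have "s \<le> j" using j by (simp add: c_less)
      then have "w = c j" using 1 j by (simp add: c_Suc)
      then show ?thesis using j i by (intro exI[of _ j]) auto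
    next
      case 2
      then have "j < s" using j by (simp add: c_le)
      then have "w = c j" using 2 j by (simp add: c_Suc)
      then show ?thesis using j i by (intro exI[of _ j]) auto
    next
      case 3
      then have "c i = c (m - 1)" using cm by simp
      then show ?thesis using 3 c0 i by (intro exI[of _ 0]) (auto simp: c_eq)
    qed
  next
    assume "\<exists>j<m. w = c j \<and> (i = Suc j \<or> j = 0 \<and> i = m - 1)"
    then obtain j where j: "j < m" "w = c j" "i = Suc j \<or> j = 0 \<and> i = m - 1" by blast
    then have "(c j, c i) \<in> ?A" using up[of j "c i"] w i cn by auto
    then show "(c i, w) \<in> ?A" using j row_graph_arc_sym by simp
  qed
  have "has_cycle_component (row_graph T) m"
  proof (rule has_cycle_componentI[where c = c])
    show "pair_sym_digraph (row_graph T)" by (rule row_graph_pair_sym_digraph)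
    show "0 < m" using m by simp
    show "inj_on c {0..<m}" by (auto simp: inj_on_def c_eq)
    show "c i \<in> pverts (row_graph T)" if "i < m" for i
      using cn[OF that] by (rule row_graph_vertex)
    fix i w assume i: "i < m"
    have Suc_mod: "x = Suc y mod m \<longleftrightarrow> x = Suc y \<or> x = 0 \<and> y = m - 1" if "x < m" "y < m" for x y
      using that by (cases "Suc y = m") auto
    have "(c i, w) \<in> ?A \<longleftrightarrow> (\<exists>j<m. w = c j \<and>
      (j = Suc i \<or> i = Suc j \<or> j = 0 \<and> i = m - 1 \<or> i = 0 \<and> j = m - 1))" (is "_ \<longleftrightarrow> ?R")
    proof (cases w "c i" rule: linorder_cases)
      case less
      then have "\<not> (\<exists>j. w = c j \<and> (j = Suc i \<or> i = 0))"
        using c0 by (auto simp: c_less)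
      then show ?thesis using down[OF i less] by blast
    next
      case equal
      then have "(c i, w) \<notin> ?A" using row_graph_arcD by blast
      moreover have "\<not> ?R" using equal m pos by (auto simp: c_eq)
      ultimately show ?thesis by simp
    next
      case greater
      show ?thesis
      proof (cases "w < n")
        case True
        have "?R \<longleftrightarrow> Suc i < m \<and> w = c (Suc i) \<or> i = 0 \<and> w = c (m - 1)"
        proof
          assume ?R
          moreover have "\<not> (w = c j \<and> (i = Suc j \<or> j = 0))" for j
            using greater c0 by (auto simp: c_less)
          ultimately show "Suc i < m \<and> w = c (Suc i) \<or> i = 0 \<and> w = c (m - 1)" by blast
        next
          assume "Suc i < m \<and> w = c (Suc i) \<or> i = 0 \<and> w = c (m - 1)"
          moreover have "m - 1 < m" using i by simp
          ultimately show ?R by blast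
        qed
        then show ?thesis using up[OF i greater True] by simp
      next
        case False
        then show ?thesis using row_graph_arcD cn by blast
      qed
    qed
    also have "?R \<longleftrightarrow> (\<exists>j<m. w = c j \<and> (j = Suc i mod m \<or> i = Suc j mod m))"
      using Suc_mod[OF i] Suc_mod[OF _ i] by blast
    finally show "(c i, w) \<in> ?A \<longleftrightarrow> (\<exists>j<m. w = c j \<and> (j = Suc i mod m \<or> i = Suc j mod m))" .
  qed
  with in_toeplitz_le2 in_toeplitz_mats show ?thesis by blast
qed

text \<open>
  For \<open>a = 1\<close>, \<open>a' = n - 2\<close>, \<open>b = n - 3\<close>, \<open>b' = n - 1\<close>, the diagonals \<open>a\<close> and \<open>a'\<close> give the edges
  \<open>{1, n - 2}\<close> and \<open>{2, n - 1}\<close>, the diagonals \<open>b\<close> and \<open>b'\<close> give \<open>{0, 2}\<close> only, and the diagonals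
  \<open>a\<close> and \<open>b\<close> give \<open>{0, n - 2}\<close> and \<open>{1, n - 1}\<close>.  Together they form the cycle
  \<open>0, 2, n - 1, 1, n - 2\<close>.
\<close>

lemma five_cycle:
  assumes "5 \<le> n"
  shows "\<exists>T \<in> toeplitz_le2. T \<in> toeplitz_mats n \<and> has_cycle_component (row_graph T) 5"
proof -
  obtain k where n: "n = k + 5" using assms by (metis le_add_diff_inverse2)
  interpret four_diagonals n 1 "k + 3" "k + 2" "k + 4"
    by unfold_locales (use n in auto)
  let ?A = "parcs (row_graph T)"
  let ?E = "{(1, k + 3), (2, k + 4), (0, 2), (0, k + 3), (1, k + 4)}"
  have up: "(u, v) \<in> ?A \<longleftrightarrow> (u, v) \<in> ?E" if "u < v" "v < n" for u v
  proof -
    have v: "v < k + 5" using that n by simp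
    have "1 \<le> u \<and> v = u + (k + 3 - 1) \<longleftrightarrow> u = 1 \<and> v = k + 3 \<or> u = 2 \<and> v = k + 4"
      using v by presburger
    moreover have "v + (k + 2) < n \<and> v = u + (k + 4 - (k + 2)) \<longleftrightarrow> u = 0 \<and> v = 2"
      unfolding n by presburger
    moreover have "v = u + 1 + (k + 2) \<longleftrightarrow> u = 0 \<and> v = k + 3 \<or> u = 1 \<and> v = k + 4"
      using v by presburger
    ultimately show ?thesis
      unfolding row_graph_arc_iff[OF that] prod.inject insert_iff empty_iff by blast
  qed
  have E_less: "u < v \<and> v < n" if "(u, v) \<in> ?E" for u v
    using that n by auto
  have arc: "(u, v) \<in> ?A \<longleftrightarrow> (u, v) \<in> ?E \<or> (v, u) \<in> ?E" for u v
    using up[of u v] up[of v u] E_less[of u v] E_less[of v u] row_graph_arcD[of u v]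
      row_graph_arc_sym[of u v] by (metis linorder_neqE_nat)
  define c where "c = (\<lambda>i. [0, 2, k + 4, 1, k + 3] ! i)"
  have less5: "i < 5 \<longleftrightarrow> i = 0 \<or> i = 1 \<or> i = 2 \<or> i = 3 \<or> i = 4" for i :: nat by auto
  have c: "c 0 = 0" "c (Suc 0) = 2" "c 2 = k + 4" "c 3 = 1" "c 4 = k + 3" by (simp_all add: c_def)
  have ex5: "(\<exists>j<5. P j) \<longleftrightarrow> P 0 \<or> P 1 \<or> P 2 \<or> P 3 \<or> P 4" for P :: "nat \<Rightarrow> bool"
    unfolding less5 by blast
  have "has_cycle_component (row_graph T) 5"
  proof (rule has_cycle_componentI[where c = c])
    show "pair_sym_digraph (row_graph T)" by (rule row_graph_pair_sym_digraph)
    show "inj_on c {0..<5}" using n by (auto simp: inj_on_def less5 c)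
    show "c i \<in> pverts (row_graph T)" if "i < 5" for i
      using that n by (intro row_graph_vertex) (auto simp: less5 c)
    show "(c i, w) \<in> ?A \<longleftrightarrow> (\<exists>j<5. w = c j \<and> (j = Suc i mod 5 \<or> i = Suc j mod 5))"
      if "i < 5" for i w
    proof -
      have "i = 0 \<or> i = 1 \<or> i = 2 \<or> i = 3 \<or> i = 4" using that by (simp only: less5)
      then show ?thesis
        unfolding ex5 arc by (elim disjE) (simp_all add: c, blast+)
    qed
  qed simp
  with in_toeplitz_le2 in_toeplitz_mats show ?thesis by blast
qed

theorem theorem3p5:
  fixes m n :: nat
  assumes "4 \<le> m" and "m \<le> n"
    and "(m, n) \<notin> {(4, 4), (4, 5), (6, 8)}"
  shows "\<exists>T \<in> toeplitz_le2. T \<in> toeplitz_mats n \<and> has_cycle_component (row_graph T) m"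
proof -
  consider "m = 5" | "n + 3 = 2 * m" "6 \<le> m" | "n + 4 = 2 * m" "7 \<le> m"
    | "n + 3 \<noteq> 2 * m" "n + 4 \<noteq> 2 * m"
    using assms by force
  then show ?thesis
  proof cases
    case 1
    then show ?thesis using five_cycle assms by simp
  next
    case 2
    show ?thesis
      by (rule two_step_cycle[where s = 2 and e = 1 and t = "m - 3" and d = 2]) (use 2 in auto)
  next
    case 3
    show ?thesis
      by (rule two_step_cycle[where s = 3 and e = 1 and t = "m - 4" and d = 2]) (use 3 in auto)
  next
    case 4
    show ?thesis
      by (rule two_step_cycle[where s = 1 and e = "n - m + 1" and t = "m - 2" and d = 1])
        (use 4 assms in auto)
  qed
qed

end
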